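(* Let $\mathcal{X}^A$ and $\mathcal{X}^B$ be irreducible, time-homogeneous, continuous-time Markov chains on the finite state spaces $\mathcal{V}^A=\{-r+3,\dots,0,1,2\}$ ($r\ge 2$) and $\mathcal{V}^B=\{1,2,\dots,s\}$ ($s\ge 2$), with stationary distributions $\pi^A$ and $\pi^B$, and let $\pi$ be the stationary distribution of the chain $\mathcal{X}$ glued from them at the states $1$ and $2$. If $$\frac{\pi^A_1}{\pi^A_2}=\frac{\pi^B_1}{\pi^B_2},$$ then $$\pi_i=\begin{cases}C\pi^A_i\pi^B_1,&\text{if }i\in\mathcal{S}^A,\\ C\pi^A_1\pi^B_1,&\text{if }i=1,\\ C\pi^A_2\pi^B_1=C\pi^A_1\pi^B_2,&\text{if }i=2,\\ C\pi^A_1\pi^B_i,&\text{if }i\in\mathcal{S}^B,\end{cases}$$ with $$C=\left(\pi^A_1+\pi^B_1-\pi^A_1(\pi^B_1+\pi^B_2)\right)^{-1}=\left(\pi^A_1+\pi^B_1-\pi^B_1(\pi^A_1+\pi^A_2)\right)^{-1}.$$ In particular, $\frac{\pi^A_1}{\pi^A_2}=\frac{\pi^B_1}{\pi^B_2}$ implies both $\frac{\pi_1}{\pi_2}=\frac{\pi^A_1}{\pi^A_2}$ and $\frac{\pi_1}{\pi_2}=\frac{\pi^B_1}{\pi^B_2}$.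
   Context: $Q^A$ and $Q^B$ are the transition rate matrices of $\mathcal{X}^A$ and $\mathcal{X}^B$: for $i\ne j$, $Q^\delta_{ij}\ge 0$ is the transition rate from $i$ to $j$, and $Q^\delta_{ii}=-\sum_{j\neq i}Q^\delta_{ij}$ ($\delta\in\{A,B\}$). Put $\mathcal{S}^A=\mathcal{V}^A\setminus\{1,2\}=\{-r+3,\dots,0\}$ and $\mathcal{S}^B=\mathcal{V}^B\setminus\{1,2\}=\{3,\dots,s\}$ (possibly empty). The glued chain $\mathcal{X}$ is the continuous-time Markov chain on $\mathcal{S}^A\cup\{1,2\}\cup\mathcal{S}^B=\{-r+3,\dots,s\}$ with transition rate matrix $$Q_{ij}=Q^A_{ij}\,\mathbf 1(i,j\le 2)+Q^B_{ij}\,\mathbf 1(i,j\ge 1).$$ The stationary distributions $\pi^A,\pi^B,\pi$ are the probability vectors with $(\pi^A)^{\mathrm T}Q^A=0$, $(\pi^B)^{\mathrm T}Q^B=0$, $\pi^{\mathrm T}Q=0$; by irreducibility they exist uniquely and are strictly positive. *)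

theory Defs
  imports Complex_Main
begin

(* A continuous-time Markov chain on a finite set V of integers is given by its
   transition rate matrix. Matrices and vectors are functions on all integers;
   only their values on V matter. *)

definition rate_matrix :: "int set \<Rightarrow> (int \<Rightarrow> int \<Rightarrow> real) \<Rightarrow> bool" where
  "rate_matrix V Q \<longleftrightarrow>
     finite V \<and>
     (\<forall>i\<in>V. \<forall>j\<in>V. i \<noteq> j \<longrightarrow> 0 \<le> Q i j) \<and>
     (\<forall>i\<in>V. Q i i = - (\<Sum>j\<in>V - {i}. Q i j))"

definition transitions :: "int set \<Rightarrow> (int \<Rightarrow> int \<Rightarrow> real) \<Rightarrow> (int \<times> int) set" where
  "transitions V Q = {(i, j). i \<in> V \<and> j \<in> V \<and> i \<noteq> j \<and> 0 < Q i j}"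

definition irreducible_chain :: "int set \<Rightarrow> (int \<Rightarrow> int \<Rightarrow> real) \<Rightarrow> bool" where
  "irreducible_chain V Q \<longleftrightarrow>
     rate_matrix V Q \<and> (\<forall>i\<in>V. \<forall>j\<in>V. (i, j) \<in> (transitions V Q)\<^sup>*)"

definition stationary_distribution ::
    "int set \<Rightarrow> (int \<Rightarrow> int \<Rightarrow> real) \<Rightarrow> (int \<Rightarrow> real) \<Rightarrow> bool" where
  "stationary_distribution V Q p \<longleftrightarrow>
     (\<forall>i\<in>V. 0 \<le> p i) \<and>
     (\<Sum>i\<in>V. p i) = 1 \<and>
     (\<forall>j\<in>V. (\<Sum>i\<in>V. p i * Q i j) = 0)"

definition states_A :: "int \<Rightarrow> int set" where
  "states_A r = {-r + 3..2}"

definition states_B :: "int \<Rightarrow> int set" where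
  "states_B s = {1..s}"

definition inner_A :: "int \<Rightarrow> int set" where
  "inner_A r = states_A r - {1, 2}"

definition inner_B :: "int \<Rightarrow> int set" where
  "inner_B s = states_B s - {1, 2}"

definition glued_states :: "int \<Rightarrow> int \<Rightarrow> int set" where
  "glued_states r s = inner_A r \<union> {1, 2} \<union> inner_B s"

(* On the glued state space, i <= 2 means that i is a state of A, and 1 <= i that
   i is a state of B, so the values of QA and QB outside their own state spaces
   do not enter. Rates between 1 and 2 (and the diagonal entries there) add up. *)
definition glued_matrix ::
    "(int \<Rightarrow> int \<Rightarrow> real) \<Rightarrow> (int \<Rightarrow> int \<Rightarrow> real) \<Rightarrow> int \<Rightarrow> int \<Rightarrow> real" where
  "glued_matrix QA QB i j =
     QA i j * of_bool (i \<le> 2 \<and> j \<le> 2) + QB i j * of_bool (1 \<le> i \<and> 1 \<le> j)"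

end

theory Submission
  imports Defs
begin

text \<open>
  The balance equations of the glued chain split as a balance over the \<open>A\<close>-states plus a balance
  over the \<open>B\<close>-states. Hence a vector on the glued states satisfies all of them as soon as its
  restriction to each part is a multiple of that part's stationary distribution
  (\<open>glued_balance\<close>), with nonnegative factors if it is to be nonnegative. The two parts
  overlap in the states \<open>1\<close> and \<open>2\<close>, so multiples \<open>a\<close> of \<open>\<pi>\<^sup>A\<close> and \<open>b\<close> of \<open>\<pi>\<^sup>B\<close> fit together exactly
  if they agree at both states. Agreement at \<open>1\<close> is arranged by \<open>a = \<pi>\<^sup>B\<^sub>1\<close> and \<open>b = \<pi>\<^sup>A\<^sub>1\<close>; agreement
  at \<open>2\<close> is then the hypothesis on the ratios.

  The glued chain is irreducible because both parts contain the state \<open>1\<close>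
  (\<open>irreducible_chain_glued\<close>), and in an irreducible chain the nonnegative solutions of the balance
  equations form a single ray (\<open>balanced_proportional\<close>). So \<open>\<pi>\<close> is a multiple of the vector just
  described, and summing its entries, with the overlap counted once, gives the
  normalising constant.
\<close>

section \<open>Balanced vectors of irreducible chains\<close>

text \<open>
  Only the balance equations and the sign are kept from the definition of a stationary distribution,
  so that differences and multiples can be taken without renormalising.
\<close>

definition balanced :: "int set \<Rightarrow> (int \<Rightarrow> int \<Rightarrow> real) \<Rightarrow> (int \<Rightarrow> real) \<Rightarrow> bool" where
  "balanced V Q p \<longleftrightarrow>
     (\<forall>i\<in>V. 0 \<le> p i) \<and> (\<forall>j\<in>V. (\<Sum>i\<in>V. p i * Q i j) = 0)"

lemma stationary_distribution_iff_balanced: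
  "stationary_distribution V Q p \<longleftrightarrow> balanced V Q p \<and> (\<Sum>i\<in>V. p i) = 1"
  by (auto simp: stationary_distribution_def balanced_def)

text \<open>
  Mass moves along transitions: if \<open>p j\<close> vanished, the balance at \<open>j\<close> would have only nonnegative
  terms, one of them the strictly positive flow from \<open>i\<close>.
\<close>

lemma balanced_pos_step:
  assumes Q: "rate_matrix V Q" and p: "balanced V Q p"
    and ij: "(i, j) \<in> transitions V Q" and pi: "0 < p i"
  shows "0 < p j"
proof (rule ccontr)
  assume "\<not> 0 < p j"
  have V: "finite V" "i \<in> V" "j \<in> V" "0 < Q i j"
    using Q ij by (auto simp: rate_matrix_def transitions_def)
  with p \<open>\<not> 0 < p j\<close> have "p j = 0"
    by (force simp: balanced_def)
  have "0 \<le> p k * Q k j" if "k \<in> V" for k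
  proof (cases "k = j")
    case True
    with \<open>p j = 0\<close> show ?thesis by simp
  next
    case False
    with p Q V that show ?thesis by (simp add: balanced_def rate_matrix_def)
  qed
  moreover have "(\<Sum>k\<in>V. p k * Q k j) = 0"
    using p V by (simp add: balanced_def)
  ultimately have "p i * Q i j = 0"
    using V by (auto simp: sum_nonneg_eq_0_iff)
  with pi V show False by simp
qed

lemma balanced_pos_everywhere:
  assumes Q: "irreducible_chain V Q" and p: "balanced V Q p"
    and i: "i \<in> V" "0 < p i" and j: "j \<in> V"
  shows "0 < p j"
proof -
  have "(i, j) \<in> (transitions V Q)\<^sup>*" and R: "rate_matrix V Q"
    using Q i j by (auto simp: irreducible_chain_def)
  then show ?thesis
    by (induction rule: rtrancl_induct) (use i balanced_pos_step[OF R p] in blast)+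
qed

lemma stationary_distribution_pos:
  assumes Q: "irreducible_chain V Q" and p: "stationary_distribution V Q p" and j: "j \<in> V"
  shows "0 < p j"
proof -
  have "(\<Sum>i\<in>V. p i) = 1" and b: "balanced V Q p"
    using p by (simp_all add: stationary_distribution_iff_balanced)
  then have "\<not> (\<forall>i\<in>V. p i = 0)"
    by (metis sum.neutral zero_neq_one)
  then obtain i where "i \<in> V" "0 < p i"
    using b by (force simp: balanced_def)
  with balanced_pos_everywhere[OF Q b] j show ?thesis by blast
qed

text \<open>
  The nonnegative solutions form one ray. Subtract from \<open>p\<close> the largest multiple of \<open>q\<close> that keeps the
  difference nonnegative. The difference is balanced and vanishes somewhere, so by
  \<open>balanced_pos_everywhere\<close> it vanishes everywhere.
\<close>

lemma balanced_proportional: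
  assumes Q: "irreducible_chain V Q" and p: "balanced V Q p" and q: "balanced V Q q"
    and q_pos: "\<forall>i\<in>V. 0 < q i" and "V \<noteq> {}"
  shows "\<exists>c. \<forall>i\<in>V. p i = c * q i"
proof -
  have fin: "finite V"
    using Q by (simp add: irreducible_chain_def rate_matrix_def)
  define c where "c = Min ((\<lambda>i. p i / q i) ` V)"
  have "c \<in> (\<lambda>i. p i / q i) ` V"
    unfolding c_def using fin \<open>V \<noteq> {}\<close> by (intro Min_in) auto
  then obtain k where k: "k \<in> V" "p k = c * q k"
    using q_pos by fastforce
  have le: "c * q i \<le> p i" if "i \<in> V" for i
  proof -
    have "c \<le> p i / q i"
      unfolding c_def using fin that by simp
    then show ?thesis
      using q_pos that by (simp add: pos_le_divide_eq)
  qed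
  define d where "d i = p i - c * q i" for i
  have "(\<Sum>i\<in>V. d i * Q i j) = (\<Sum>i\<in>V. p i * Q i j) - c * (\<Sum>i\<in>V. q i * Q i j)" for j
    by (simp add: d_def left_diff_distrib sum_subtractf sum_distrib_left mult.assoc)
  then have d: "balanced V Q d"
    using p q le by (simp add: balanced_def d_def)
  have "d i = 0" if "i \<in> V" for i
  proof (rule ccontr)
    assume "d i \<noteq> 0"
    with d that have "0 < d i"
      by (force simp: balanced_def)
    then have "0 < d k"
      using balanced_pos_everywhere[OF Q d that] k by blast
    with k show False by (simp add: d_def)
  qed
  then show ?thesis
    by (auto simp: d_def)
qed

section \<open>The glued chain\<close>

lemma glued_states_eq_Un:
  assumes "2 \<le> r" and "2 \<le> s"
  shows "glued_states r s = states_A r \<union> states_B s"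
  using assms by (auto simp: glued_states_def inner_A_def inner_B_def states_A_def states_B_def)

text \<open>
  The indicators in the glued rates select exactly the two state spaces, which turns every row or
  column sum of the glued matrix into one sum for each part. The removed set \<open>D\<close> allows for the
  diagonal entry that the row sums leave out.
\<close>

lemma sum_glued_split:
  fixes f g :: "int \<Rightarrow> real"
  assumes "2 \<le> r" and "2 \<le> s"
  shows "(\<Sum>k\<in>glued_states r s - D. f k * of_bool (k \<le> 2) + g k * of_bool (1 \<le> k)) =
    (\<Sum>k\<in>states_A r - D. f k) + (\<Sum>k\<in>states_B s - D. g k)"
proof -
  let ?V = "glued_states r s - D"
  have fin: "finite ?V"
    by (simp add: glued_states_eq_Un[OF assms] states_A_def states_B_def)
  have A: "states_A r - D = ?V \<inter> {k. k \<le> 2}" and B: "states_B s - D = ?V \<inter> {k. 1 \<le> k}"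
    using assms by (auto simp: glued_states_eq_Un states_A_def states_B_def)
  show ?thesis
    unfolding A B sum.distrib by (simp add: fin sum.inter_restrict of_bool_def if_distrib cong: if_cong)
qed

lemma rate_matrix_glued:
  assumes rs: "2 \<le> r" "2 \<le> s"
    and A: "rate_matrix (states_A r) QA" and B: "rate_matrix (states_B s) QB"
  shows "rate_matrix (glued_states r s) (glued_matrix QA QB)"
  unfolding rate_matrix_def
proof (intro conjI ballI impI)
  let ?V = "glued_states r s"
  note V = glued_states_eq_Un[OF rs]
  show "finite ?V"
    by (simp add: V states_A_def states_B_def)
  fix i assume i: "i \<in> ?V"
  have in_A: "k \<in> states_A r" if "k \<in> ?V" "k \<le> 2" for k
    using that rs by (auto simp: V states_A_def states_B_def)
  have in_B: "k \<in> states_B s" if "k \<in> ?V" "1 \<le> k" for k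
    using that rs by (auto simp: V states_A_def states_B_def)
  show "0 \<le> glued_matrix QA QB i j" if "j \<in> ?V" "i \<noteq> j" for j
    using i that A B in_A in_B by (auto simp: glued_matrix_def rate_matrix_def)
  have "(\<Sum>j\<in>?V - {i}. glued_matrix QA QB i j) =
      (\<Sum>j\<in>?V - {i}. (of_bool (i \<le> 2) * QA i j) * of_bool (j \<le> 2) +
                     (of_bool (1 \<le> i) * QB i j) * of_bool (1 \<le> j))"
    by (intro sum.cong) (auto simp: glued_matrix_def)
  also have "\<dots> = of_bool (i \<le> 2) * (\<Sum>j\<in>states_A r - {i}. QA i j) +
      of_bool (1 \<le> i) * (\<Sum>j\<in>states_B s - {i}. QB i j)"
    unfolding sum_glued_split[OF rs] sum_distrib_left ..
  also have "\<dots> = - glued_matrix QA QB i i"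
    using i A B in_A in_B by (auto simp: glued_matrix_def rate_matrix_def)
  finally show "glued_matrix QA QB i i = - (\<Sum>j\<in>?V - {i}. glued_matrix QA QB i j)"
    by simp
qed

text \<open>
  Gluing only adds nonnegative rates, so every transition of either part survives. Paths inside a
  part therefore remain available, and a path between the parts can be routed through the
  common state \<open>1\<close>.
\<close>

lemma irreducible_chain_glued:
  assumes rs: "2 \<le> r" "2 \<le> s"
    and A: "irreducible_chain (states_A r) QA" and B: "irreducible_chain (states_B s) QB"
  shows "irreducible_chain (glued_states r s) (glued_matrix QA QB)"
proof -
  let ?V = "glued_states r s" and ?Q = "glued_matrix QA QB"
  let ?T = "transitions ?V ?Q"
  note V = glued_states_eq_Un[OF rs]
  have RA: "rate_matrix (states_A r) QA" and RB: "rate_matrix (states_B s) QB"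
    using A B by (simp_all add: irreducible_chain_def)
  have "transitions (states_A r) QA \<subseteq> ?T"
    using RB rs by (auto simp: transitions_def V glued_matrix_def rate_matrix_def
        states_A_def states_B_def add_pos_nonneg)
  then have TA: "(i, j) \<in> ?T\<^sup>*" if "i \<in> states_A r" "j \<in> states_A r" for i j
    using A that rtrancl_mono unfolding irreducible_chain_def by blast
  have "transitions (states_B s) QB \<subseteq> ?T"
    using RA rs by (auto simp: transitions_def V glued_matrix_def rate_matrix_def
        states_A_def states_B_def add_nonneg_pos)
  then have TB: "(i, j) \<in> ?T\<^sup>*" if "i \<in> states_B s" "j \<in> states_B s" for i j
    using B that rtrancl_mono unfolding irreducible_chain_def by blast
  have one: "1 \<in> states_A r" "1 \<in> states_B s"
    using rs by (auto simp: states_A_def states_B_def)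
  have "(i, j) \<in> ?T\<^sup>*" if "i \<in> ?V" "j \<in> ?V" for i j
  proof (rule rtrancl_trans)
    show "(i, 1) \<in> ?T\<^sup>*" "(1, j) \<in> ?T\<^sup>*"
      using that one TA TB by (auto simp: V)
  qed
  then show ?thesis
    using rate_matrix_glued[OF rs RA RB] by (simp add: irreducible_chain_def)
qed

text \<open>
  Since the multiples \<open>a * pA\<close> and \<open>b * pB\<close> agree on the overlap, \<open>w\<close> may be read as either of them
  there; so each part contributes its own balance, which is zero.
\<close>

lemma glued_balance:
  assumes rs: "2 \<le> r" "2 \<le> s"
    and A: "balanced (states_A r) QA pA" and B: "balanced (states_B s) QB pB"
    and wA: "\<forall>i\<in>states_A r. w i = a * pA i" and wB: "\<forall>i\<in>states_B s. w i = b * pB i"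
    and ab: "0 \<le> a" "0 \<le> b"
  shows "balanced (glued_states r s) (glued_matrix QA QB) w"
  unfolding balanced_def
proof (intro conjI ballI)
  note V = glued_states_eq_Un[OF rs]
  show "0 \<le> w i" if "i \<in> glued_states r s" for i
    using that A B wA wB ab by (auto simp: V balanced_def)
  fix j assume j: "j \<in> glued_states r s"
  have "(\<Sum>i\<in>glued_states r s. w i * glued_matrix QA QB i j) =
      (\<Sum>i\<in>glued_states r s - {}. (of_bool (j \<le> 2) * (w i * QA i j)) * of_bool (i \<le> 2) +
                     (of_bool (1 \<le> j) * (w i * QB i j)) * of_bool (1 \<le> i))"
    by (intro sum.cong) (auto simp: glued_matrix_def algebra_simps)
  also have "\<dots> = of_bool (j \<le> 2) * (\<Sum>i\<in>states_A r. w i * QA i j) +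
      of_bool (1 \<le> j) * (\<Sum>i\<in>states_B s. w i * QB i j)"
    unfolding sum_glued_split[OF rs] sum_distrib_left by simp
  also have "(\<Sum>i\<in>states_A r. w i * QA i j) = a * (\<Sum>i\<in>states_A r. pA i * QA i j)"
    unfolding sum_distrib_left using wA by (intro sum.cong) auto
  also have "(\<Sum>i\<in>states_B s. w i * QB i j) = b * (\<Sum>i\<in>states_B s. pB i * QB i j)"
    unfolding sum_distrib_left using wB by (intro sum.cong) auto
  also have "of_bool (j \<le> 2) * (a * (\<Sum>i\<in>states_A r. pA i * QA i j)) +
      of_bool (1 \<le> j) * (b * (\<Sum>i\<in>states_B s. pB i * QB i j)) = 0"
    using A B j rs by (auto simp: balanced_def V states_A_def states_B_def)
  finally show "(\<Sum>i\<in>glued_states r s. w i * glued_matrix QA QB i j) = 0" .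
qed

section \<open>The stationary distribution of the glued chain\<close>

theorem theorem5:
  fixes r s :: int
    and QA QB :: "int \<Rightarrow> int \<Rightarrow> real"
    and pA pB p :: "int \<Rightarrow> real"
  assumes "2 \<le> r" and "2 \<le> s"
    and "irreducible_chain (states_A r) QA"
    and "irreducible_chain (states_B s) QB"
    and "stationary_distribution (states_A r) QA pA"
    and "stationary_distribution (states_B s) QB pB"
    and "stationary_distribution (glued_states r s) (glued_matrix QA QB) p"
    and "pA 1 / pA 2 = pB 1 / pB 2"
  shows "let C = inverse (pA 1 + pB 1 - pA 1 * (pB 1 + pB 2)) in
      pA 1 + pB 1 - pA 1 * (pB 1 + pB 2) \<noteq> 0 \<and>
      pA 1 + pB 1 - pB 1 * (pA 1 + pA 2) \<noteq> 0 \<and>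
      C = inverse (pA 1 + pB 1 - pB 1 * (pA 1 + pA 2)) \<and>
      (\<forall>i\<in>inner_A r. p i = C * pA i * pB 1) \<and>
      p 1 = C * pA 1 * pB 1 \<and>
      p 2 = C * pA 2 * pB 1 \<and>
      C * pA 2 * pB 1 = C * pA 1 * pB 2 \<and>
      (\<forall>i\<in>inner_B s. p i = C * pA 1 * pB i) \<and>
      p 1 / p 2 = pA 1 / pA 2 \<and>
      p 1 / p 2 = pB 1 / pB 2"
proof -
  let ?A = "states_A r" and ?B = "states_B s" and ?V = "glued_states r s"
  let ?D = "pA 1 + pB 1 - pA 1 * (pB 1 + pB 2)"
  note rs = assms(1,2)
  note V = glued_states_eq_Un[OF rs]
  have overlap: "1 \<in> ?A" "2 \<in> ?A" "1 \<in> ?B" "2 \<in> ?B"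
    using rs by (auto simp: states_A_def states_B_def)
  have pos_A: "0 < pA i" if "i \<in> ?A" for i
    using stationary_distribution_pos[OF assms(3,5) that] .
  have pos_B: "0 < pB i" if "i \<in> ?B" for i
    using stationary_distribution_pos[OF assms(4,6) that] .
  have pos: "0 < pA 1" "0 < pA 2" "0 < pB 1" "0 < pB 2"
    using pos_A pos_B overlap by auto
  have cross: "pA 2 * pB 1 = pA 1 * pB 2"
    using assms(8) pos by (simp add: field_simps)

  define w where "w i = (if i \<le> 2 then pB 1 * pA i else pA 1 * pB i)" for i
  have w_A: "\<forall>i\<in>?A. w i = pB 1 * pA i"
    by (auto simp: w_def states_A_def)
  have w_B: "\<forall>i\<in>?B. w i = pA 1 * pB i"
  proof
    fix i assume "i \<in> ?B"
    then consider "i = 1" | "i = 2" | "2 < i"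
      by (force simp: states_B_def)
    then show "w i = pA 1 * pB i"
      using cross by cases (auto simp: w_def mult.commute)
  qed
  have w_pos: "\<forall>i\<in>?V. 0 < w i"
    using w_A w_B pos pos_A pos_B by (auto simp: V)
  have w_bal: "balanced ?V (glued_matrix QA QB) w"
    using glued_balance[OF rs _ _ w_A w_B] assms(5,6) pos
    by (auto simp: stationary_distribution_iff_balanced)
  have p_bal: "balanced ?V (glued_matrix QA QB) p" and p_sum: "(\<Sum>i\<in>?V. p i) = 1"
    using assms(7) by (simp_all add: stationary_distribution_iff_balanced)
  have "?V \<noteq> {}"
    using overlap by (auto simp: V)
  then obtain C where C: "\<forall>i\<in>?V. p i = C * w i"
    using balanced_proportional[OF irreducible_chain_glued[OF rs assms(3,4)] p_bal w_bal w_pos]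
    by blast

  have "?V = ?A \<union> (?B - {1, 2})" "?A \<inter> (?B - {1, 2}) = {}"
    using rs by (auto simp: V states_A_def states_B_def)
  then have "(\<Sum>i\<in>?V. w i) = (\<Sum>i\<in>?A. w i) + (\<Sum>i\<in>?B - {1, 2}. w i)"
    by (simp add: sum.union_disjoint states_A_def states_B_def)
  also have "(\<Sum>i\<in>?A. w i) = pB 1 * (\<Sum>i\<in>?A. pA i)"
    unfolding sum_distrib_left using w_A by (intro sum.cong) auto
  also have "(\<Sum>i\<in>?B - {1, 2}. w i) = pA 1 * (\<Sum>i\<in>?B - {1, 2}. pB i)"
    unfolding sum_distrib_left using w_B by (intro sum.cong) auto
  also have "(\<Sum>i\<in>?B - {1, 2}. pB i) = (\<Sum>i\<in>?B. pB i) - (pB 1 + pB 2)"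
    using overlap by (subst sum_diff) (auto simp: states_B_def)
  finally have w_sum: "(\<Sum>i\<in>?V. w i) = ?D"
    using assms(5,6) by (simp add: stationary_distribution_def algebra_simps)
  have "(\<Sum>i\<in>?V. p i) = C * (\<Sum>i\<in>?V. w i)"
    unfolding sum_distrib_left using C by (intro sum.cong) auto
  then have CD: "C * ?D = 1"
    using p_sum w_sum by simp
  then have D: "?D \<noteq> 0"
    by (metis mult_zero_right zero_neq_one)
  have C_eq: "inverse ?D = C"
    using CD by (intro inverse_unique) (simp add: mult.commute)
  have D': "pA 1 + pB 1 - pB 1 * (pA 1 + pA 2) = ?D"
    using cross by (simp add: algebra_simps)
  have p_A: "p i = C * pA i * pB 1" if "i \<in> ?A" for i
    using C w_A that by (simp add: V)
  have p_B: "p i = C * pA 1 * pB i" if "i \<in> ?B" for i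
    using C w_B that by (simp add: V)
  have "C \<noteq> 0"
    using CD by auto
  then have "p 1 / p 2 = pA 1 / pA 2" "p 1 / p 2 = pB 1 / pB 2"
    using pos overlap by (simp_all add: p_A[of 1] p_A[of 2] assms(8)[symmetric])
  then show ?thesis
    unfolding Let_def D' C_eq
    using D cross p_A p_B overlap by (auto simp: inner_A_def inner_B_def)
qed

end
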